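(* Let $(M_1,\dots,M_p,Y)$ be a centered process with finite variance on $D\subset\mathbb{R}^d$ such that the covariance matrix $K_M(x)$ of $M(x)=(M_1(x),\dots,M_p(x))^t$ is invertible for all $x\in D$. Let $X$ be the matrix of observation points $x_1,\dots,x_n\in D$, let $M_{\mathcal{A}}(x)$ be the nested Kriging predictor and $v_{\mathcal{A}}(x)=\mathrm{E}[(Y(x)-M_{\mathcal{A}}(x))^2]$, and let $Y_{\mathcal{A}}$ be the aggregated process (see context). Suppose that $M_{\mathcal{A}}$ is a deterministic and interpolating function of $Y(X)$, i.e. for any $x\in D$ there exists a deterministic function $g_x:\mathbb{R}^n\to\mathbb{R}$ such that $M_{\mathcal{A}}(x)=g_x(Y(X))$, and $M_{\mathcal{A}}(X)=Y(X)$. (This holds in particular if both of the following are satisfied: (linearity) for all $x\in D$ there is a deterministic $p\times n$ matrix $\Lambda(x)$ with $M(x)=\Lambda(x)Y(X)$; (interpolation) for every observation point $x_k$ there is at least one index $i_k\in\{1,\dots,p\}$ such that $M_{i_k}(x_k)=Y(x_k)$.) Then, for all $x\in D$, $$M_{\mathcal{A}}(x)=\mathrm{E}\big[Y_{\mathcal{A}}(x)\mid Y_{\mathcal{A}}(X)\big],\qquad v_{\mathcal{A}}(x)=\mathrm{Var}\big[Y_{\mathcal{A}}(x)\mid Y_{\mathcal{A}}(X)\big].$$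
   Context: $Y(X)$ denotes the vector $(Y(x_1),\dots,Y(x_n))^t$, and similarly $M_{\mathcal{A}}(X)$, $Y_{\mathcal{A}}(X)$. With $k_M(x)$ the $p\times1$ vector with entries $\mathrm{Cov}[M_i(x),Y(x)]$, the nested Kriging predictor is $M_{\mathcal{A}}(x)=k_M(x)^tK_M(x)^{-1}M(x)$, the best linear predictor of $Y(x)$ from $M_1(x),\dots,M_p(x)$. Aggregated process: $Y_{\mathcal{A}}=M_{\mathcal{A}}+\varepsilon'_{\mathcal{A}}$, where $\varepsilon'_{\mathcal{A}}$ is an independent replicate of the process $Y-M_{\mathcal{A}}$ (i.e. a process on $D$ with the same distribution as $Y-M_{\mathcal{A}}$, independent of $(M_1,\dots,M_p,Y)$). Equalities between random variables are almost sure.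
   Formalization: The deterministic function g_x with M_A(x) = g_x(Y(X)) is required to be Borel measurable; for an arbitrary function g_x the claim can fail on suitable probability spaces. *)

theory Defs
  imports "HOL-Probability.Probability"
begin

text \<open>
  A process on an index set \<open>D\<close> over a probability space \<open>P\<close> is a function of an index
  and an outcome; only its values at indices in \<open>D\<close> matter. The index set lies in
  \<open>real ^ 'd\<close>, and \<open>M x \<omega>\<close> is the column vector of \<open>M\<^sub>1(x), \<dots>, M\<^sub>p(x)\<close>.
\<close>

definition centered_finite_variance :: "'w measure \<Rightarrow> 'i set \<Rightarrow> ('i \<Rightarrow> 'w \<Rightarrow> real) \<Rightarrow> bool" where
  "centered_finite_variance P D U \<longleftrightarrow>
     (\<forall>x\<in>D. U x \<in> borel_measurable P \<and> integrable P (\<lambda>\<omega>. (U x \<omega>)\<^sup>2)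
            \<and> (\<integral>\<omega>. U x \<omega> \<partial>P) = 0)"

definition covariance :: "'w measure \<Rightarrow> ('w \<Rightarrow> real) \<Rightarrow> ('w \<Rightarrow> real) \<Rightarrow> real" where
  "covariance P U V =
     (\<integral>\<omega>. (U \<omega> - (\<integral>\<omega>'. U \<omega>' \<partial>P)) * (V \<omega> - (\<integral>\<omega>'. V \<omega>' \<partial>P)) \<partial>P)"

definition K_M :: "'w measure \<Rightarrow> ('i \<Rightarrow> 'w \<Rightarrow> real ^ 'p) \<Rightarrow> 'i \<Rightarrow> real ^ 'p ^ 'p" where
  "K_M P M x = (\<chi> i j. covariance P (\<lambda>\<omega>. M x \<omega> $ i) (\<lambda>\<omega>. M x \<omega> $ j))"

definition k_M ::
    "'w measure \<Rightarrow> ('i \<Rightarrow> 'w \<Rightarrow> real ^ 'p) \<Rightarrow> ('i \<Rightarrow> 'w \<Rightarrow> real) \<Rightarrow> 'i \<Rightarrow> real ^ 'p" where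
  "k_M P M Y x = (\<chi> i. covariance P (\<lambda>\<omega>. M x \<omega> $ i) (Y x))"

definition nested_predictor ::
    "'w measure \<Rightarrow> ('i \<Rightarrow> 'w \<Rightarrow> real ^ 'p) \<Rightarrow> ('i \<Rightarrow> 'w \<Rightarrow> real) \<Rightarrow> 'i \<Rightarrow> 'w \<Rightarrow> real" where
  "nested_predictor P M Y x \<omega> = k_M P M Y x \<bullet> (matrix_inv (K_M P M x) *v M x \<omega>)"

definition nested_variance ::
    "'w measure \<Rightarrow> ('i \<Rightarrow> 'w \<Rightarrow> real ^ 'p) \<Rightarrow> ('i \<Rightarrow> 'w \<Rightarrow> real) \<Rightarrow> 'i \<Rightarrow> real" where
  "nested_variance P M Y x = (\<integral>\<omega>. (Y x \<omega> - nested_predictor P M Y x \<omega>)\<^sup>2 \<partial>P)"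

text \<open>The vector \<open>(U(x\<^sub>1), \<dots>, U(x\<^sub>n))\<close>; the rows of \<open>X\<close> are the observation points.\<close>

definition at_points :: "('i \<Rightarrow> 'w \<Rightarrow> real) \<Rightarrow> 'i ^ 'n \<Rightarrow> 'w \<Rightarrow> real ^ 'n" where
  "at_points U X \<omega> = (\<chi> k. U (X $ k) \<omega>)"

text \<open>
  Independence and equality in law of processes are those of their paths, taken in the product
  space over \<open>D\<close> with its product \<open>\<sigma>\<close>-algebra. Independence is phrased through \<open>indep_set\<close>
  because \<open>indep_var\<close> requires both variables to have the same value type.
\<close>

definition path_on :: "'i set \<Rightarrow> ('i \<Rightarrow> 'w \<Rightarrow> 's) \<Rightarrow> 'w \<Rightarrow> 'i \<Rightarrow> 's" where
  "path_on D Z \<omega> = (\<lambda>x\<in>D. Z x \<omega>)"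

definition path_algebra ::
    "'w measure \<Rightarrow> 'i set \<Rightarrow> ('i \<Rightarrow> 'w \<Rightarrow> 's::topological_space) \<Rightarrow> 'w measure" where
  "path_algebra P D Z = vimage_algebra (space P) (path_on D Z) (\<Pi>\<^sub>M x\<in>D. borel)"

definition same_law ::
    "'w measure \<Rightarrow> 'i set \<Rightarrow> ('i \<Rightarrow> 'w \<Rightarrow> 's::topological_space) \<Rightarrow> ('i \<Rightarrow> 'w \<Rightarrow> 's) \<Rightarrow> bool" where
  "same_law P D Z Z' \<longleftrightarrow>
     distr P (\<Pi>\<^sub>M x\<in>D. borel) (path_on D Z) = distr P (\<Pi>\<^sub>M x\<in>D. borel) (path_on D Z')"

definition independent_replicate ::
    "'w measure \<Rightarrow> 'i set \<Rightarrow> ('i \<Rightarrow> 'w \<Rightarrow> 's::topological_space)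
      \<Rightarrow> ('i \<Rightarrow> 'w \<Rightarrow> 't::topological_space) \<Rightarrow> ('i \<Rightarrow> 'w \<Rightarrow> 's) \<Rightarrow> bool" where
  "independent_replicate P D Z V Z' \<longleftrightarrow>
     (\<forall>x\<in>D. Z' x \<in> borel_measurable P) \<and> same_law P D Z' Z \<and>
     prob_space.indep_set P (sets (path_algebra P D Z')) (sets (path_algebra P D V))"

definition aggregated_process ::
    "'w measure \<Rightarrow> ('i \<Rightarrow> 'w \<Rightarrow> real ^ 'p) \<Rightarrow> ('i \<Rightarrow> 'w \<Rightarrow> real) \<Rightarrow> ('i \<Rightarrow> 'w \<Rightarrow> real)
      \<Rightarrow> 'i \<Rightarrow> 'w \<Rightarrow> real" where
  "aggregated_process P M Y \<epsilon> x \<omega> = nested_predictor P M Y x \<omega> + \<epsilon> x \<omega>"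

definition cond_exp_given ::
    "'w measure \<Rightarrow> ('w \<Rightarrow> real) \<Rightarrow> ('w \<Rightarrow> 't::topological_space) \<Rightarrow> 'w \<Rightarrow> real" where
  "cond_exp_given P U V = real_cond_exp P (vimage_algebra (space P) V borel) U"

definition cond_var_given ::
    "'w measure \<Rightarrow> ('w \<Rightarrow> real) \<Rightarrow> ('w \<Rightarrow> 't::topological_space) \<Rightarrow> 'w \<Rightarrow> real" where
  "cond_var_given P U V = cond_exp_given P (\<lambda>\<omega>. (U \<omega> - cond_exp_given P U V \<omega>)\<^sup>2) V"

text \<open>
  The function \<open>g\<close> is required to be Borel. Without measurability, \<open>g(V)\<close> can be a random
  variable that is independent of \<open>V\<close> and not constant, on a suitable probability space.
\<close>

definition deterministic_function_of ::
    "'w measure \<Rightarrow> 'i set \<Rightarrow> ('i \<Rightarrow> 'w \<Rightarrow> real) \<Rightarrow> ('w \<Rightarrow> real ^ 'n) \<Rightarrow> bool" where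
  "deterministic_function_of P D U V \<longleftrightarrow>
     (\<forall>x\<in>D. \<exists>g \<in> borel_measurable borel. AE \<omega> in P. U x \<omega> = g (V \<omega>))"

definition deterministic_interpolating ::
    "'w measure \<Rightarrow> 'i set \<Rightarrow> 'i ^ 'n \<Rightarrow> ('i \<Rightarrow> 'w \<Rightarrow> real ^ 'p) \<Rightarrow> ('i \<Rightarrow> 'w \<Rightarrow> real) \<Rightarrow> bool" where
  "deterministic_interpolating P D X M Y \<longleftrightarrow>
     deterministic_function_of P D (nested_predictor P M Y) (at_points Y X) \<and>
     (AE \<omega> in P. at_points (nested_predictor P M Y) X \<omega> = at_points Y X \<omega>)"

definition linear_submodels ::
    "'w measure \<Rightarrow> 'i set \<Rightarrow> 'i ^ 'n \<Rightarrow> ('i \<Rightarrow> 'w \<Rightarrow> real ^ 'p) \<Rightarrow> ('i \<Rightarrow> 'w \<Rightarrow> real) \<Rightarrow> bool" where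
  "linear_submodels P D X M Y \<longleftrightarrow>
     (\<forall>x\<in>D. \<exists>\<Lambda> :: real ^ 'n ^ 'p. AE \<omega> in P. M x \<omega> = \<Lambda> *v at_points Y X \<omega>)"

definition interpolating_submodels ::
    "'w measure \<Rightarrow> 'i ^ 'n \<Rightarrow> ('i \<Rightarrow> 'w \<Rightarrow> real ^ 'p) \<Rightarrow> ('i \<Rightarrow> 'w \<Rightarrow> real) \<Rightarrow> bool" where
  "interpolating_submodels P X M Y \<longleftrightarrow>
     (\<forall>k. \<exists>i. AE \<omega> in P. M (X $ k) \<omega> $ i = Y (X $ k) \<omega>)"

end

theory Submission
  imports Defs
begin

text \<open>
  Interpolation forces \<open>Y - M\<^sub>\<A>\<close>, hence also its replicate \<open>\<epsilon>\<close>, to vanish almost surely at the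
  observation points, so \<open>Y\<^sub>\<A>(X) = M\<^sub>\<A>(X) = Y(X)\<close> almost surely. Conditionally on this vector,
  \<open>M\<^sub>\<A>(x)\<close> is known and \<open>\<epsilon>(x)\<close> is independent of it, so \<open>Y\<^sub>\<A>(x) = M\<^sub>\<A>(x) + \<epsilon>(x)\<close> has conditional
  mean \<open>M\<^sub>\<A>(x) + E[\<epsilon>(x)] = M\<^sub>\<A>(x)\<close> and conditional variance \<open>E[\<epsilon>(x)\<^sup>2] = v\<^sub>\<A>(x)\<close>.
\<close>

section \<open>Square integrability of sums and of centered processes\<close>

lemma integrable_add_square:
  fixes f g :: "'a \<Rightarrow> real"
  assumes [measurable]: "f \<in> borel_measurable P" "g \<in> borel_measurable P"
    and "integrable P (\<lambda>\<omega>. (f \<omega>)\<^sup>2)" "integrable P (\<lambda>\<omega>. (g \<omega>)\<^sup>2)"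
  shows "integrable P (\<lambda>\<omega>. (f \<omega> + g \<omega>)\<^sup>2)"
proof (rule Bochner_Integration.integrable_bound)
  show "integrable P (\<lambda>\<omega>. 2 * (f \<omega>)\<^sup>2 + 2 * (g \<omega>)\<^sup>2)"
    using assms by simp
  \<comment> \<open>The right side minus the left side is \<open>(a - b)^2\<close>, so the sum of
    the two integrable squares dominates.\<close>
  have "(a + b)\<^sup>2 \<le> 2 * a\<^sup>2 + 2 * b\<^sup>2" for a b :: real
    using zero_le_power2[of "a - b"] by (simp add: power2_eq_square algebra_simps)
  then show "AE \<omega> in P. norm ((f \<omega> + g \<omega>)\<^sup>2) \<le> norm (2 * (f \<omega>)\<^sup>2 + 2 * (g \<omega>)\<^sup>2)"
    by simp
qed simp

lemma integrable_sum_square: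
  fixes f :: "'i \<Rightarrow> 'a \<Rightarrow> real"
  assumes "finite I"
    and "\<And>i. i \<in> I \<Longrightarrow> f i \<in> borel_measurable P"
    and "\<And>i. i \<in> I \<Longrightarrow> integrable P (\<lambda>\<omega>. (f i \<omega>)\<^sup>2)"
  shows "integrable P (\<lambda>\<omega>. (\<Sum>i\<in>I. f i \<omega>)\<^sup>2)"
  using assms
proof (induction I rule: finite_induct)
  case (insert j I)
  have "integrable P (\<lambda>\<omega>. (f j \<omega> + (\<Sum>i\<in>I. f i \<omega>))\<^sup>2)"
    using insert by (intro integrable_add_square borel_measurable_sum) auto
  then show ?case using insert.hyps by simp
qed simp

lemma (in prob_space) centered_finite_variance_inner:
  fixes Z :: "'i \<Rightarrow> 'a \<Rightarrow> real ^ 'p"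
  assumes "\<forall>i. centered_finite_variance M D (\<lambda>x \<omega>. Z x \<omega> $ i)"
  shows "centered_finite_variance M D (\<lambda>x \<omega>. c x \<bullet> Z x \<omega>)"
  unfolding centered_finite_variance_def
proof (intro ballI conjI)
  fix x assume x: "x \<in> D"
  have m[measurable]: "(\<lambda>\<omega>. Z x \<omega> $ i) \<in> borel_measurable M"
    and s: "integrable M (\<lambda>\<omega>. (Z x \<omega> $ i)\<^sup>2)"
    and z: "expectation (\<lambda>\<omega>. Z x \<omega> $ i) = 0" for i
    using assms x by (auto simp: centered_finite_variance_def)
  have i: "integrable M (\<lambda>\<omega>. Z x \<omega> $ i)" for i
    using m s by (rule square_integrable_imp_integrable)
  show "(\<lambda>\<omega>. c x \<bullet> Z x \<omega>) \<in> borel_measurable M"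
    unfolding inner_vec_def inner_real_def by measurable
  show "integrable M (\<lambda>\<omega>. (c x \<bullet> Z x \<omega>)\<^sup>2)"
    unfolding inner_vec_def inner_real_def
    using s by (intro integrable_sum_square) (auto simp: power_mult_distrib)
  show "expectation (\<lambda>\<omega>. c x \<bullet> Z x \<omega>) = 0"
    unfolding inner_vec_def inner_real_def using i z by simp
qed

lemma (in prob_space) centered_finite_variance_diff:
  assumes "centered_finite_variance M D U" "centered_finite_variance M D V"
  shows "centered_finite_variance M D (\<lambda>x \<omega>. U x \<omega> - V x \<omega>)"
  unfolding centered_finite_variance_def
proof (intro ballI conjI)
  fix x assume x: "x \<in> D"
  have m[measurable]: "U x \<in> borel_measurable M" "V x \<in> borel_measurable M"
    and s: "integrable M (\<lambda>\<omega>. (U x \<omega>)\<^sup>2)" "integrable M (\<lambda>\<omega>. (V x \<omega>)\<^sup>2)"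
    and z: "expectation (U x) = 0" "expectation (V x) = 0"
    using assms x by (auto simp: centered_finite_variance_def)
  have i: "integrable M (U x)" "integrable M (V x)"
    using m s by (auto intro: square_integrable_imp_integrable)
  show "(\<lambda>\<omega>. U x \<omega> - V x \<omega>) \<in> borel_measurable M"
    by measurable
  show "integrable M (\<lambda>\<omega>. (U x \<omega> - V x \<omega>)\<^sup>2)"
    using integrable_add_square[of "U x" M "\<lambda>\<omega>. - V x \<omega>"] s by simp
  show "expectation (\<lambda>\<omega>. U x \<omega> - V x \<omega>) = 0"
    using i z by simp
qed

text \<open>Moving the inverse covariance matrix to the other side of the inner product exhibits the
  predictor as a linear combination of the submodels with deterministic coefficients, so that it
  inherits mean zero and finite variance from them.\<close>

lemma nested_predictor_eq_inner:
  "nested_predictor P M Y x \<omega> = (transpose (matrix_inv (K_M P M x)) *v k_M P M Y x) \<bullet> M x \<omega>"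
  unfolding nested_predictor_def by (simp add: dot_lmul_matrix[symmetric])

lemma (in prob_space) centered_finite_variance_nested_predictor:
  assumes "\<forall>i. centered_finite_variance M D (\<lambda>x \<omega>. Z x \<omega> $ i)"
  shows "centered_finite_variance M D (nested_predictor M Z Y)"
  unfolding nested_predictor_eq_inner[abs_def]
  by (rule centered_finite_variance_inner[OF assms])

section \<open>Borel measurability of random vectors\<close>

lemma borel_measurable_vec:
  fixes f :: "'w \<Rightarrow> real ^ 'n"
  assumes [measurable]: "\<And>k. (\<lambda>\<omega>. f \<omega> $ k) \<in> borel_measurable P"
  shows "f \<in> borel_measurable P"
proof -
  have "(\<lambda>\<omega>. f \<omega> \<bullet> b) \<in> borel_measurable P" for b
    unfolding inner_vec_def inner_real_def by measurable
  then show ?thesis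
    by (subst borel_measurable_euclidean_space) auto
qed

lemma borel_measurable_at_points:
  assumes "\<And>k. U (X $ k) \<in> borel_measurable P"
  shows "at_points U X \<in> borel_measurable P"
  using assms by (intro borel_measurable_vec) (simp add: at_points_def)

section \<open>Linear and interpolating submodels\<close>

lemma matrix_inv_right:
  fixes A :: "real ^ 'n ^ 'n"
  assumes "invertible A"
  shows "A ** matrix_inv A = mat 1"
  using someI_ex[OF assms[unfolded invertible_def]] by (simp add: matrix_inv_def)

lemma covariance_cong_AE:
  assumes "AE \<omega> in P. V \<omega> = W \<omega>"
    and [measurable]: "U \<in> borel_measurable P" "V \<in> borel_measurable P" "W \<in> borel_measurable P"
  shows "covariance P U V = covariance P U W"
proof -
  have "(\<integral>\<omega>. V \<omega> \<partial>P) = (\<integral>\<omega>. W \<omega> \<partial>P)"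
    using assms by (intro integral_cong_AE) auto
  then show ?thesis
    unfolding covariance_def using assms(1) by (intro integral_cong_AE) auto
qed

lemma transpose_K_M: "transpose (K_M P M x) = K_M P M x"
  by (simp add: transpose_def K_M_def covariance_def vec_eq_iff mult.commute)

text \<open>If the \<open>i\<close>-th submodel agrees almost surely with \<open>Y x\<close>, then
  \<open>k_M\<close> is the \<open>i\<close>-th column of \<open>K_M\<close>; by symmetry of
  \<open>K_M\<close> the inverse cancels and the predictor selects the \<open>i\<close>-th
  component. The almost sure equality only enters through covariances, which are numbers, so the
  conclusion holds for every outcome.\<close>

lemma nested_predictor_interpolates:
  fixes M :: "'i \<Rightarrow> 'w \<Rightarrow> real ^ 'p"
  assumes inv: "invertible (K_M P M x)"
    and [measurable]: "\<And>j. (\<lambda>\<omega>. M x \<omega> $ j) \<in> borel_measurable P" "Y x \<in> borel_measurable P"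
    and eq: "AE \<omega> in P. M x \<omega> $ i = Y x \<omega>"
  shows "nested_predictor P M Y x \<omega> = M x \<omega> $ i"
proof -
  have "covariance P (\<lambda>\<omega>. M x \<omega> $ j) (\<lambda>\<omega>. M x \<omega> $ i) = covariance P (\<lambda>\<omega>. M x \<omega> $ j) (Y x)" for j
    using eq by (intro covariance_cong_AE) auto
  then have "k_M P M Y x = K_M P M x *v axis i 1"
    by (simp add: k_M_def K_M_def matrix_vector_mult_basis column_def vec_eq_iff)
  then have "nested_predictor P M Y x \<omega>
      = (K_M P M x *v axis i 1) \<bullet> (matrix_inv (K_M P M x) *v M x \<omega>)"
    by (simp add: nested_predictor_def)
  also have "\<dots> = axis i 1 \<bullet> (K_M P M x *v (matrix_inv (K_M P M x) *v M x \<omega>))"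
    by (metis dot_lmul_matrix transpose_K_M transpose_matrix_vector)
  also have "\<dots> = axis i 1 \<bullet> M x \<omega>"
    by (simp add: matrix_vector_mul_assoc matrix_inv_right[OF inv])
  also have "\<dots> = M x \<omega> $ i"
    by (simp add: inner_axis')
  finally show ?thesis .
qed

text \<open>Linearity of the submodels makes the predictor a linear function of the observations. At
  an observation point the predictor coincides with the submodel that interpolates there.\<close>

lemma deterministic_interpolating_if_linear_interpolating:
  fixes M :: "'i \<Rightarrow> 'w \<Rightarrow> real ^ 'p" and X :: "'i ^ 'n"
  assumes meas: "\<And>x j. x \<in> D \<Longrightarrow> (\<lambda>\<omega>. M x \<omega> $ j) \<in> borel_measurable P"
      "\<And>x. x \<in> D \<Longrightarrow> Y x \<in> borel_measurable P"
    and inv: "\<forall>x\<in>D. invertible (K_M P M x)"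
    and X: "\<forall>k. X $ k \<in> D"
    and lin: "linear_submodels P D X M Y" and int: "interpolating_submodels P X M Y"
  shows "deterministic_interpolating P D X M Y"
  unfolding deterministic_interpolating_def deterministic_function_of_def
proof (intro conjI ballI)
  fix x assume "x \<in> D"
  then obtain L :: "real ^ 'n ^ 'p" where L: "AE \<omega> in P. M x \<omega> = L *v at_points Y X \<omega>"
    using lin by (auto simp: linear_submodels_def)
  define g :: "real ^ 'n \<Rightarrow> real"
    where "g v = k_M P M Y x \<bullet> (matrix_inv (K_M P M x) *v (L *v v))" for v
  \<comment> \<open>The two matrices are merged into one linear map, so that \<open>g\<close> is
    continuous and therefore Borel, as \<open>deterministic_function_of\<close> demands.\<close>
  have "continuous_on UNIV (\<lambda>v. (matrix_inv (K_M P M x) ** L) *v v)"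
    by (rule linear_continuous_on[OF matrix_vector_mul_bounded_linear])
  then have "continuous_on UNIV g"
    unfolding g_def by (auto simp: matrix_vector_mul_assoc intro: continuous_on_inner)
  then have "g \<in> borel_measurable borel"
    by (rule borel_measurable_continuous_onI)
  moreover have "AE \<omega> in P. nested_predictor P M Y x \<omega> = g (at_points Y X \<omega>)"
    using L by (auto simp: g_def nested_predictor_def)
  ultimately show "\<exists>g \<in> borel_measurable borel.
      AE \<omega> in P. nested_predictor P M Y x \<omega> = g (at_points Y X \<omega>)"
    by blast
next
  have "AE \<omega> in P. nested_predictor P M Y (X $ k) \<omega> = Y (X $ k) \<omega>" for k
  proof -
    obtain i where i: "AE \<omega> in P. M (X $ k) \<omega> $ i = Y (X $ k) \<omega>"
      using int by (auto simp: interpolating_submodels_def)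
    have "nested_predictor P M Y (X $ k) \<omega> = M (X $ k) \<omega> $ i" for \<omega>
      using inv X meas i by (intro nested_predictor_interpolates) auto
    then show ?thesis using i by simp
  qed
  then have "AE \<omega> in P. \<forall>k\<in>UNIV. nested_predictor P M Y (X $ k) \<omega> = Y (X $ k) \<omega>"
    by (intro AE_finite_allI) auto
  then show "AE \<omega> in P. at_points (nested_predictor P M Y) X \<omega> = at_points Y X \<omega>"
    by (auto simp: at_points_def)
qed

section \<open>Path algebras and marginal laws of processes\<close>

lemma measurable_path_on:
  assumes "\<And>x. x \<in> D \<Longrightarrow> Z x \<in> borel_measurable P"
  shows "path_on D Z \<in> measurable P (\<Pi>\<^sub>M x\<in>D. borel)"
  unfolding path_on_def using assms by (intro measurable_restrict) auto

lemma subalgebra_path_algebra: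
  assumes "\<And>x. x \<in> D \<Longrightarrow> Z x \<in> borel_measurable P"
  shows "subalgebra P (path_algebra P D Z)"
  unfolding subalgebra_def path_algebra_def
proof (rule conjI[rotated])
  have "path_on D Z \<in> space P \<rightarrow> space (\<Pi>\<^sub>M x\<in>D. borel)"
    by (auto simp: space_PiM path_on_def)
  moreover have "path_on D Z \<in> measurable P (\<Pi>\<^sub>M x\<in>D. borel)"
    using assms by (rule measurable_path_on)
  ultimately show "sets (vimage_algebra (space P) (path_on D Z) (\<Pi>\<^sub>M x\<in>D. borel)) \<subseteq> sets P"
    by (auto simp: sets_vimage_algebra2 intro: measurable_sets)
qed simp

text \<open>The value at \<open>x\<close> is the path followed by a coordinate projection, which is
  measurable for the product algebra. This places single values of a process in the algebra in terms
  of which independence is stated.\<close>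

lemma measurable_path_algebra_component:
  assumes "x \<in> D"
  shows "Z x \<in> borel_measurable (path_algebra P D Z)"
proof -
  have "path_on D Z \<in> measurable (path_algebra P D Z) (\<Pi>\<^sub>M x\<in>D. borel)"
    unfolding path_algebra_def
    by (intro measurable_vimage_algebra1) (auto simp: space_PiM path_on_def)
  from measurable_compose[OF this measurable_component_singleton[OF assms]]
  have "(\<lambda>\<omega>. path_on D Z \<omega> x) \<in> borel_measurable (path_algebra P D Z)" .
  then show ?thesis using assms by (simp add: path_on_def)
qed

text \<open>Each one-dimensional marginal is the image of the path law under a coordinate
  projection, so equal path laws have equal marginals.\<close>

lemma same_law_distr:
  fixes Z Z' :: "'i \<Rightarrow> 'w \<Rightarrow> 's::topological_space"
  assumes "same_law P D Z' Z" "x \<in> D"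
    and meas: "\<And>x. x \<in> D \<Longrightarrow> Z x \<in> borel_measurable P" "\<And>x. x \<in> D \<Longrightarrow> Z' x \<in> borel_measurable P"
  shows "distr P borel (Z' x) = distr P borel (Z x)"
proof -
  have "distr P borel (U x) = distr (distr P (\<Pi>\<^sub>M x\<in>D. borel) (path_on D U)) borel (\<lambda>p. p x)"
    if "\<And>x. x \<in> D \<Longrightarrow> U x \<in> borel_measurable P" for U :: "'i \<Rightarrow> 'w \<Rightarrow> 's"
    using \<open>x \<in> D\<close>
    by (subst distr_distr[OF measurable_component_singleton measurable_path_on[OF that]])
       (auto simp: path_on_def comp_def)
  from this[of Z] this[of Z'] show ?thesis
    using assms(1) meas by (simp add: same_law_def)
qed

section \<open>Transfer between random variables with the same distribution\<close>

context
  fixes P :: "'w measure" and U V :: "'w \<Rightarrow> real"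
  assumes d: "distr P borel U = distr P borel V"
    and [measurable]: "U \<in> borel_measurable P" "V \<in> borel_measurable P"
begin

lemma integral_eq_if_distr_eq:
  fixes f :: "real \<Rightarrow> real"
  assumes [measurable]: "f \<in> borel_measurable borel"
  shows "(\<integral>\<omega>. f (U \<omega>) \<partial>P) = (\<integral>\<omega>. f (V \<omega>) \<partial>P)"
  using integral_distr[of U P borel f] integral_distr[of V P borel f] d by simp

lemma integrable_iff_if_distr_eq:
  fixes f :: "real \<Rightarrow> real"
  assumes [measurable]: "f \<in> borel_measurable borel"
  shows "integrable P (\<lambda>\<omega>. f (U \<omega>)) \<longleftrightarrow> integrable P (\<lambda>\<omega>. f (V \<omega>))"
  using integrable_distr_eq[of U P borel f] integrable_distr_eq[of V P borel f] d by simp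

lemma AE_iff_if_distr_eq:
  assumes [measurable]: "Measurable.pred borel Q"
  shows "(AE \<omega> in P. Q (U \<omega>)) \<longleftrightarrow> (AE \<omega> in P. Q (V \<omega>))"
  using AE_distr_iff[of U P borel Q] AE_distr_iff[of V P borel Q] assms
  unfolding d by (simp add: pred_def)

end

section \<open>Conditional expectation of an independent variable\<close>

lemma (in prob_space) expectation_mult_indicator_indep:
  fixes f :: "'a \<Rightarrow> real"
  assumes G: "subalgebra M G" and H: "subalgebra M H"
    and indep: "indep_set (sets G) (sets H)"
    and f: "f \<in> borel_measurable G" "integrable M f" and C: "C \<in> sets H"
  shows "expectation (\<lambda>\<omega>. f \<omega> * indicator C \<omega>) = expectation f * prob C"
proof -
  have spG: "space G = space M" and spH: "space H = space M"
    using G H by (auto simp: subalgebra_def)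
  have CM[measurable]: "C \<in> sets M"
    using H C by (auto simp: subalgebra_def)
  have iC: "(indicator C :: 'a \<Rightarrow> real) \<in> borel_measurable H"
    using C by simp
  \<comment> \<open>The algebras generated by \<open>f\<close> and by the indicator lie in the
    independent algebras \<open>G\<close> and \<open>H\<close>, so the two real variables are
    independent and the expectation of their product factorizes.\<close>
  have "indep_var borel f borel (indicator C :: 'a \<Rightarrow> real)"
    unfolding indep_var_eq indep_set_def
  proof (intro conjI indep_sets_mono_sets[OF indep[unfolded indep_set_def]])
    have "sigma_sets (space M) {f -` A \<inter> space M |A. A \<in> sets borel} \<subseteq> sets G"
      unfolding spG[symmetric] using f(1) by (intro sets.sigma_sets_subset) auto
    moreover have "sigma_sets (space M) {(indicator C :: 'a \<Rightarrow> real) -` A \<inter> space M |A. A \<in> sets borel} \<subseteq> sets H"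
      unfolding spH[symmetric] using iC by (intro sets.sigma_sets_subset) auto
    ultimately show "case_bool (sigma_sets (space M) {f -` A \<inter> space M |A. A \<in> sets borel})
       (sigma_sets (space M) {(indicator C :: 'a \<Rightarrow> real) -` A \<inter> space M |A. A \<in> sets borel}) i
      \<subseteq> case_bool (sets G) (sets H) i" for i
      by (cases i) auto
  qed (use f in auto)
  from indep_var_lebesgue_integral[OF this f(2)] show ?thesis
    using sets.sets_into_space[OF CM] by (simp add: Int_absorb2 less_top[symmetric])
qed

text \<open>
  \<open>F\<close> is only required to lie in \<open>H\<close> up to null sets: it is generated by \<open>Y\<^sub>\<A>(X)\<close>, which equals
  the \<open>H\<close>-measurable \<open>Y(X)\<close> only almost surely.
\<close>
lemma (in prob_space) real_cond_exp_indep: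
  fixes f :: "'a \<Rightarrow> real"
  assumes F: "subalgebra M F" and G: "subalgebra M G" and H: "subalgebra M H"
    and indep: "indep_set (sets G) (sets H)"
    and f: "f \<in> borel_measurable G" "integrable M f"
    and FH: "\<And>B. B \<in> sets F \<Longrightarrow> \<exists>C\<in>sets H. AE \<omega> in M. \<omega> \<in> B \<longleftrightarrow> \<omega> \<in> C"
  shows "AE \<omega> in M. real_cond_exp M F f \<omega> = expectation f"
proof -
  interpret finite_measure_subalgebra M F
    by unfold_locales (rule F)
  show ?thesis
  \<comment> \<open>A constant is measurable for \<open>F\<close>, so it only remains to compare the
    integrals of \<open>f\<close> and of its mean over each \<open>B\<close> in \<open>F\<close>.
    There \<open>B\<close> is exchanged for the almost surely equal \<open>C\<close> in
    \<open>H\<close>, where independence applies.\<close>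
  proof (rule real_cond_exp_charact)
    fix B assume B: "B \<in> sets F"
    then obtain C where C: "C \<in> sets H" and BC: "AE \<omega> in M. \<omega> \<in> B \<longleftrightarrow> \<omega> \<in> C"
      using FH by blast
    have [measurable]: "B \<in> sets M" "C \<in> sets M" "f \<in> borel_measurable M"
      using B C F H f by (auto simp: subalgebra_def)
    have "(LINT \<omega>:B|M. f \<omega>) = expectation (\<lambda>\<omega>. f \<omega> * indicator C \<omega>)"
      unfolding set_lebesgue_integral_def using BC
      by (intro integral_cong_AE) (auto simp: indicator_def)
    also have "\<dots> = expectation f * prob C"
      by (rule expectation_mult_indicator_indep[OF G H indep f C])
    also have "prob C = prob B"
      using BC by (intro finite_measure_eq_AE) auto
    finally show "(LINT \<omega>:B|M. f \<omega>) = (LINT \<omega>:B|M. expectation f)"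
      by (simp add: set_lebesgue_integral_def)
  qed (use f in auto)
qed

section \<open>Conditional mean and variance of the aggregated process\<close>

theorem proposition3:
  fixes P :: "'w measure"
    and D :: "(real ^ 'd) set"
    and M :: "real ^ 'd \<Rightarrow> 'w \<Rightarrow> real ^ 'p"
    and Y :: "real ^ 'd \<Rightarrow> 'w \<Rightarrow> real"
    and X :: "(real ^ 'd) ^ 'n"
  assumes "prob_space P"
    and "\<forall>i. centered_finite_variance P D (\<lambda>x \<omega>. M x \<omega> $ i)"
    and "centered_finite_variance P D Y"
    and "\<forall>x\<in>D. invertible (K_M P M x)"
    and "\<forall>k. X $ k \<in> D"
  shows "(linear_submodels P D X M Y \<and> interpolating_submodels P X M Y
            \<longrightarrow> deterministic_interpolating P D X M Y) \<and>
         (deterministic_interpolating P D X M Y \<longrightarrow>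
           (\<forall>\<epsilon> :: real ^ 'd \<Rightarrow> 'w \<Rightarrow> real.
              independent_replicate P D (\<lambda>x \<omega>. Y x \<omega> - nested_predictor P M Y x \<omega>)
                (\<lambda>x \<omega>. (M x \<omega>, Y x \<omega>)) \<epsilon> \<longrightarrow>
              (\<forall>x\<in>D.
                (AE \<omega> in P. nested_predictor P M Y x \<omega>
                   = cond_exp_given P (aggregated_process P M Y \<epsilon> x)
                       (at_points (aggregated_process P M Y \<epsilon>) X) \<omega>) \<and>
                (AE \<omega> in P. nested_variance P M Y x
                   = cond_var_given P (aggregated_process P M Y \<epsilon> x)
                       (at_points (aggregated_process P M Y \<epsilon>) X) \<omega>))))"
proof (intro conjI impI allI ballI)
  interpret prob_space P by fact
  have mM: "(\<lambda>\<omega>. M x \<omega> $ j) \<in> borel_measurable P" and mY: "Y x \<in> borel_measurable P"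
    if "x \<in> D" for x j
    using assms that by (auto simp: centered_finite_variance_def)
  show "deterministic_interpolating P D X M Y"
    if "linear_submodels P D X M Y \<and> interpolating_submodels P X M Y"
    using that assms mM mY by (intro deterministic_interpolating_if_linear_interpolating) auto
  fix \<epsilon> :: "real ^ 'd \<Rightarrow> 'w \<Rightarrow> real" and x
  assume det: "deterministic_interpolating P D X M Y"
    and rep: "independent_replicate P D (\<lambda>x \<omega>. Y x \<omega> - nested_predictor P M Y x \<omega>)
      (\<lambda>x \<omega>. (M x \<omega>, Y x \<omega>)) \<epsilon>"
    and x: "x \<in> D"
  define A where "A = nested_predictor P M Y"
  define R where "R = (\<lambda>x \<omega>. Y x \<omega> - A x \<omega>)"
  define U where "U = aggregated_process P M Y \<epsilon>"
  define V where "V = at_points U X"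
  \<comment> \<open>\<open>F\<close> is the conditioning algebra, \<open>G\<close> carries the
    replicate \<epsilon>, and \<open>H\<close> carries the submodels together with \<open>Y\<close>;
    independence is between \<open>G\<close> and \<open>H\<close>.\<close>
  define F where "F = vimage_algebra (space P) V borel"
  define G where "G = path_algebra P D \<epsilon>"
  define H where "H = path_algebra P D (\<lambda>x \<omega>. (M x \<omega>, Y x \<omega>))"
  have cA: "centered_finite_variance P D A"
    unfolding A_def by (rule centered_finite_variance_nested_predictor[OF assms(2)])
  have cR: "centered_finite_variance P D R"
    unfolding R_def by (rule centered_finite_variance_diff[OF assms(3) cA])
  have mA: "A y \<in> borel_measurable P" and mR: "R y \<in> borel_measurable P"
    and m\<epsilon>: "\<epsilon> y \<in> borel_measurable P" if "y \<in> D" for y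
    using cA cR rep that by (auto simp: centered_finite_variance_def independent_replicate_def)
  have U: "U y = (\<lambda>\<omega>. A y \<omega> + \<epsilon> y \<omega>)" for y
    by (simp add: U_def A_def aggregated_process_def fun_eq_iff)
  have mU: "U y \<in> borel_measurable P" if "y \<in> D" for y
    unfolding U using mA[OF that] m\<epsilon>[OF that] by simp
  have law: "distr P borel (\<epsilon> y) = distr P borel (R y)" if "y \<in> D" for y
    using rep that mR m\<epsilon> by (intro same_law_distr[of P D]) (auto simp: independent_replicate_def R_def A_def)
  have "AE \<omega> in P. U (X $ k) \<omega> = Y (X $ k) \<omega>" for k
  proof -
    have Xk: "X $ k \<in> D" using assms(5) by simp
    have *: "AE \<omega> in P. A (X $ k) \<omega> = Y (X $ k) \<omega>"
      using det by (auto simp: deterministic_interpolating_def at_points_def vec_eq_iff A_def)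
    then have "AE \<omega> in P. R (X $ k) \<omega> = 0"
      by (auto simp: R_def)
    \<comment> \<open>Vanishing almost surely at one point is a property of the marginal law there,
      hence it passes from the residual \<open>R\<close> to its replicate.\<close>
    then have "AE \<omega> in P. \<epsilon> (X $ k) \<omega> = 0"
      using AE_iff_if_distr_eq[OF law m\<epsilon> mR, of "X $ k" "\<lambda>r. r = 0"] Xk by simp
    then show ?thesis using * by (auto simp: U)
  qed
  then have "AE \<omega> in P. \<forall>k\<in>UNIV. U (X $ k) \<omega> = Y (X $ k) \<omega>"
    by (intro AE_finite_allI) auto
  then have VY: "AE \<omega> in P. V \<omega> = at_points Y X \<omega>"
    by (auto simp: V_def at_points_def)
  have mV: "V \<in> borel_measurable P"
    unfolding V_def using mU assms(5) by (intro borel_measurable_at_points) auto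
  have sF: "subalgebra P F"
    unfolding subalgebra_def F_def using measurable_sets[OF mV] by (auto simp: sets_vimage_algebra2)
  have sG: "subalgebra P G"
    unfolding G_def using m\<epsilon> by (rule subalgebra_path_algebra)
  \<comment> \<open>Measurability of \<open>M y\<close> is assumed component by component, whereas
    the path of the pair needs it as a vector.\<close>
  have "M y \<in> borel_measurable P" if "y \<in> D" for y
    using mM[OF that] by (rule borel_measurable_vec)
  then have sH: "subalgebra P H"
    unfolding H_def using mY by (intro subalgebra_path_algebra borel_measurable_Pair)
  have indep: "indep_set (sets G) (sets H)"
    using rep by (simp add: independent_replicate_def G_def H_def)
  have YH: "at_points Y X \<in> borel_measurable H"
  proof (rule borel_measurable_at_points)
    fix k
    have "(\<lambda>\<omega>. (M (X $ k) \<omega>, Y (X $ k) \<omega>)) \<in> borel_measurable H"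
      unfolding H_def using assms(5)
      by (intro measurable_path_algebra_component[where Z = "\<lambda>x \<omega>. (M x \<omega>, Y x \<omega>)"]) simp
    then have "(\<lambda>\<omega>. snd (M (X $ k) \<omega>, Y (X $ k) \<omega>)) \<in> borel_measurable H"
      by (rule measurable_compose) (intro borel_measurable_continuous_onI continuous_intros)
    then show "Y (X $ k) \<in> borel_measurable H" by simp
  qed
  \<comment> \<open>A set of \<open>F\<close> is a preimage under \<open>V\<close>; the preimage of
    the same Borel set under \<open>Y(X)\<close> lies in \<open>H\<close> and differs from it by a
    null set.\<close>
  have FH: "\<exists>C\<in>sets H. AE \<omega> in P. \<omega> \<in> B \<longleftrightarrow> \<omega> \<in> C" if B: "B \<in> sets F" for B
  proof -
    obtain S where S: "S \<in> sets borel" "B = V -` S \<inter> space P"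
      using B by (auto simp: F_def sets_vimage_algebra2)
    have "space H = space P" using sH by (simp add: subalgebra_def)
    then have "at_points Y X -` S \<inter> space P \<in> sets H"
      using measurable_sets[OF YH S(1)] by simp
    moreover have "AE \<omega> in P. \<omega> \<in> B \<longleftrightarrow> \<omega> \<in> at_points Y X -` S \<inter> space P"
      using VY by (auto simp: S(2))
    ultimately show ?thesis by blast
  qed
  interpret finite_measure_subalgebra P F
    by unfold_locales (rule sF)
  note [measurable] = mA[OF x] mR[OF x] m\<epsilon>[OF x] mU[OF x]
  note law_x = law[OF x] m\<epsilon>[OF x] mR[OF x]
  have iR: "integrable P (\<lambda>\<omega>. (R x \<omega>)\<^sup>2)" and iA: "integrable P (\<lambda>\<omega>. (A x \<omega>)\<^sup>2)"
    and eR: "expectation (R x) = 0"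
    using cR cA x by (auto simp: centered_finite_variance_def)
  \<comment> \<open>The moments of the replicate are those of the residual: its mean is zero, and
    its second moment is the nested variance by definition.\<close>
  have i\<epsilon>2: "integrable P (\<lambda>\<omega>. (\<epsilon> x \<omega>)\<^sup>2)"
    using integrable_iff_if_distr_eq[OF law_x, of "\<lambda>r. r\<^sup>2"] iR by simp
  have i\<epsilon>: "integrable P (\<epsilon> x)" and iA1: "integrable P (A x)"
    using i\<epsilon>2 iA by (auto intro: square_integrable_imp_integrable)
  have e\<epsilon>: "expectation (\<epsilon> x) = 0"
    using integral_eq_if_distr_eq[OF law_x, of "\<lambda>r. r"] eR by simp
  have e\<epsilon>2: "expectation (\<lambda>\<omega>. (\<epsilon> x \<omega>)\<^sup>2) = nested_variance P M Y x"
    using integral_eq_if_distr_eq[OF law_x, of "\<lambda>r. r\<^sup>2"]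
    by (simp add: nested_variance_def R_def A_def)
  have \<epsilon>G: "\<epsilon> x \<in> borel_measurable G"
    unfolding G_def using x by (rule measurable_path_algebra_component)
  have c\<epsilon>: "AE \<omega> in P. real_cond_exp P F (\<epsilon> x) \<omega> = 0"
    using real_cond_exp_indep[OF sF sG sH indep \<epsilon>G i\<epsilon> FH] e\<epsilon> by simp
  have \<epsilon>2G: "(\<lambda>\<omega>. (\<epsilon> x \<omega>)\<^sup>2) \<in> borel_measurable G"
    using \<epsilon>G by simp
  have c\<epsilon>2: "AE \<omega> in P. real_cond_exp P F (\<lambda>\<omega>. (\<epsilon> x \<omega>)\<^sup>2) \<omega> = nested_variance P M Y x"
    using real_cond_exp_indep[OF sF sG sH indep \<epsilon>2G i\<epsilon>2 FH] e\<epsilon>2 by simp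
  obtain g where g: "g \<in> borel_measurable borel"
    and Ag: "AE \<omega> in P. A x \<omega> = g (at_points Y X \<omega>)"
    using det x by (auto simp: deterministic_interpolating_def deterministic_function_of_def A_def)
  \<comment> \<open>The function \<open>g\<close> is applied to \<open>V\<close> instead of
    \<open>Y(X)\<close>: the result is measurable for \<open>F\<close> and still almost surely equal
    to \<open>A x\<close>, so \<open>A x\<close> is its own conditional expectation.\<close>
  have "V \<in> measurable F borel"
    unfolding F_def by (rule measurable_vimage_algebra1) simp
  then have gF: "(\<lambda>\<omega>. g (V \<omega>)) \<in> borel_measurable F"
    using g by (rule measurable_compose)
  have [measurable]: "(\<lambda>\<omega>. g (V \<omega>)) \<in> borel_measurable P"
    using gF sF by (rule measurable_from_subalg[rotated])
  have AgV: "AE \<omega> in P. A x \<omega> = g (V \<omega>)"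
    using Ag VY by auto
  have "integrable P (\<lambda>\<omega>. g (V \<omega>))"
    using iA1 AgV by (subst integrable_cong_AE[of _ _ "A x"]) auto
  from real_cond_exp_F_meas[OF this gF] real_cond_exp_cong[OF AgV]
  have cA': "AE \<omega> in P. real_cond_exp P F (A x) \<omega> = A x \<omega>"
    using AgV by auto
  have cU: "AE \<omega> in P. real_cond_exp P F (U x) \<omega> = A x \<omega>"
    using real_cond_exp_add[OF iA1 i\<epsilon>] cA' c\<epsilon> unfolding U by auto
  then show "AE \<omega> in P. nested_predictor P M Y x \<omega>
     = cond_exp_given P (aggregated_process P M Y \<epsilon> x) (at_points (aggregated_process P M Y \<epsilon>) X) \<omega>"
    by (auto simp: cond_exp_given_def F_def V_def U_def A_def)
  \<comment> \<open>The conditional mean is \<open>A x\<close>, so centering \<open>U x\<close>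
    leaves exactly the replicate, whose square has a constant conditional expectation.\<close>
  have "AE \<omega> in P. (U x \<omega> - real_cond_exp P F (U x) \<omega>)\<^sup>2 = (\<epsilon> x \<omega>)\<^sup>2"
    using cU by (auto simp: U)
  then have "AE \<omega> in P. real_cond_exp P F (\<lambda>\<omega>. (U x \<omega> - real_cond_exp P F (U x) \<omega>)\<^sup>2) \<omega>
      = real_cond_exp P F (\<lambda>\<omega>. (\<epsilon> x \<omega>)\<^sup>2) \<omega>"
    by (rule real_cond_exp_cong) auto
  then show "AE \<omega> in P. nested_variance P M Y x
     = cond_var_given P (aggregated_process P M Y \<epsilon> x) (at_points (aggregated_process P M Y \<epsilon>) X) \<omega>"
    using c\<epsilon>2 by (auto simp: cond_var_given_def cond_exp_given_def F_def V_def U_def)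
qed

end
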